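(* For a dynamical system $(X,f)$ the following conditions are equivalent: (i) $(X,f)$ is topologically transitive, i.e. for every pair $U,V$ of opene subsets of $X$ the set $N(U,V)$ is nonempty. (ii) $X$ does not contain two disjoint, opene, $-$invariant subsets. (iii) $X$ is not the union of two proper, closed, $+$invariant subsets.
   Context: A dynamical system $(X,f)$ is a continuous map $f\colon X\to X$ on a nonempty topological space $X$ (no separation axiom is assumed). A set is opene if it is open and nonempty. For $A\subset X$, $k\in\mathbb Z$, $f^k(A)$ is the image of $A$ under $f^k$ if $k\ge 0$ and the preimage of $A$ under $f^{|k|}$ if $k<0$. $A\subset X$ is $+$invariant if $f(A)\subset A$ and $-$invariant if $f^{-1}(A)\subset A$. For $A,B\subset X$: $N(A,B)=\{k\in\mathbb Z: A\cap f^{-k}(B)\ne\varnothing\}$. *)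

theory Defs
  imports "HOL-Analysis.Abstract_Topology"
begin

text \<open>The space is the carrier \<open>topspace X\<close> of an abstract topology; values of \<open>f\<close> outside
  the carrier play no role.\<close>

definition dynamical_system :: "'a topology \<Rightarrow> ('a \<Rightarrow> 'a) \<Rightarrow> bool" where
  "dynamical_system X f \<longleftrightarrow> topspace X \<noteq> {} \<and> continuous_map X X f"

definition opene :: "'a topology \<Rightarrow> 'a set \<Rightarrow> bool" where
  "opene X U \<longleftrightarrow> openin X U \<and> U \<noteq> {}"

text \<open>\<open>iter_set X f k A\<close> is \<open>f\<^sup>k(A)\<close> for \<open>A \<subseteq> topspace X\<close>. Preimages are taken
  within the carrier.\<close>

definition iter_set :: "'a topology \<Rightarrow> ('a \<Rightarrow> 'a) \<Rightarrow> int \<Rightarrow> 'a set \<Rightarrow> 'a set" where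
  "iter_set X f k A =
     (if k \<ge> 0 then (f ^^ nat k) ` A
      else {x \<in> topspace X. (f ^^ nat \<bar>k\<bar>) x \<in> A})"

definition plus_invariant :: "'a topology \<Rightarrow> ('a \<Rightarrow> 'a) \<Rightarrow> 'a set \<Rightarrow> bool" where
  "plus_invariant X f A \<longleftrightarrow> A \<subseteq> topspace X \<and> f ` A \<subseteq> A"

definition minus_invariant :: "'a topology \<Rightarrow> ('a \<Rightarrow> 'a) \<Rightarrow> 'a set \<Rightarrow> bool" where
  "minus_invariant X f A \<longleftrightarrow> A \<subseteq> topspace X \<and> {x \<in> topspace X. f x \<in> A} \<subseteq> A"

definition hitting_times :: "'a topology \<Rightarrow> ('a \<Rightarrow> 'a) \<Rightarrow> 'a set \<Rightarrow> 'a set \<Rightarrow> int set" where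
  "hitting_times X f A B = {k. A \<inter> iter_set X f (- k) B \<noteq> {}}"

definition topologically_transitive :: "'a topology \<Rightarrow> ('a \<Rightarrow> 'a) \<Rightarrow> bool" where
  "topologically_transitive X f \<longleftrightarrow>
     (\<forall>U V. opene X U \<and> opene X V \<longrightarrow> hitting_times X f U V \<noteq> {})"

end

(* Two open sets miss each other along all orbits iff their backward saturations, which are open
   and -invariant, are disjoint; complementation exchanges open -invariant and closed
   +invariant sets. *)
theory Submission
  imports Defs
begin

text \<open>The sign of the time \<open>k\<close> decides the direction: a positive one takes a
  point of \<open>U\<close> forward into \<open>V\<close>, a negative one exhibits a point of
  \<open>U\<close> as a forward iterate of a point of \<open>V\<close>. Hence natural exponents
  suffice, at the price of a disjunction symmetric in \<open>U\<close> and \<open>V\<close>.\<close>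

lemma hitting_times_nonempty_iff:
  assumes "U \<subseteq> topspace X" "V \<subseteq> topspace X"
  shows "hitting_times X f U V \<noteq> {} \<longleftrightarrow>
           (\<exists>n. (\<exists>x\<in>U. (f ^^ n) x \<in> V) \<or> (\<exists>y\<in>V. (f ^^ n) y \<in> U))"
    (is "?L \<longleftrightarrow> ?R")
proof
  assume ?L
  then obtain k x where "x \<in> U" "x \<in> iter_set X f (- k) V"
    by (auto simp: hitting_times_def)
  then show ?R
    by (auto simp: iter_set_def split: if_splits)
next
  assume ?R
  then obtain n where n: "(\<exists>x\<in>U. (f ^^ n) x \<in> V) \<or> (\<exists>y\<in>V. (f ^^ n) y \<in> U)" ..
  then have "int n \<in> hitting_times X f U V \<or> - int n \<in> hitting_times X f U V"
    \<comment> \<open>Time 0 falls under the image case of \<open>iter_set\<close>, while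
      \<open>int n\<close> with \<open>n > 0\<close> falls under the preimage case, so the two are
      treated separately.\<close>
    using assms by (cases "n = 0") (auto simp: hitting_times_def iter_set_def)
  then show ?L by blast
qed

lemma continuous_map_funpow:
  assumes "continuous_map X X f"
  shows "continuous_map X X (f ^^ n)"
proof (induction n)
  case (Suc n)
  then show ?case
    using continuous_map_compose[OF Suc assms] by (simp add: comp_def)
qed simp

text \<open>Membership in \<open>A\<close> is pulled back along the orbit one step at a time. The
  induction generalises \<open>x\<close> because its hypothesis is applied to \<open>f x\<close>,
  which stays in the carrier.\<close>

lemma minus_invariant_funpow:
  assumes f: "continuous_map X X f" and A: "minus_invariant X f A"
    and x: "x \<in> topspace X" "(f ^^ n) x \<in> A"
  shows "x \<in> A"
  using x
proof (induction n arbitrary: x)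
  case (Suc n)
  have "f x \<in> topspace X"
    using f Suc.prems(1) by (auto simp: continuous_map_def)
  moreover have "(f ^^ n) (f x) \<in> A"
    using Suc.prems(2) by (simp add: funpow_swap1)
  ultimately have "f x \<in> A" by (rule Suc.IH)
  then show ?case
    using A Suc.prems(1) by (auto simp: minus_invariant_def)
qed simp

text \<open>For continuous \<open>f\<close> and \<open>U\<close> inside the carrier this is the
  smallest -invariant set containing \<open>U\<close>.\<close>

definition backward_saturation :: "'a topology \<Rightarrow> ('a \<Rightarrow> 'a) \<Rightarrow> 'a set \<Rightarrow> 'a set" where
  "backward_saturation X f U = {x \<in> topspace X. \<exists>n. (f ^^ n) x \<in> U}"

lemma opene_backward_saturation:
  assumes f: "continuous_map X X f" and U: "opene X U"
  shows "opene X (backward_saturation X f U)"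
proof -
  have eq: "backward_saturation X f U = (\<Union>n. {x \<in> topspace X. (f ^^ n) x \<in> U})"
    by (auto simp: backward_saturation_def)
  \<comment> \<open>Every iterate is continuous, so the saturation is a union of open preimages;
    exponent 0 will show that it contains \<open>U\<close> and so is nonempty.\<close>
  have "openin X {x \<in> topspace X. (f ^^ n) x \<in> U}" for n
    using U continuous_map_funpow[OF f]
    by (intro openin_continuous_map_preimage) (auto simp: opene_def)
  then have "openin X (backward_saturation X f U)"
    unfolding eq by blast
  moreover have "U \<subseteq> backward_saturation X f U"
  proof
    fix x assume "x \<in> U"
    then have "x \<in> topspace X" "(f ^^ 0) x \<in> U"
      using U by (auto simp: opene_def dest: openin_subset)
    then show "x \<in> backward_saturation X f U"
      unfolding backward_saturation_def by blast
  qed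
  ultimately show ?thesis
    using U by (auto simp: opene_def)
qed

lemma minus_invariant_backward_saturation:
  "minus_invariant X f (backward_saturation X f U)"
proof -
  have "\<exists>m. (f ^^ m) x \<in> U" if "(f ^^ n) (f x) \<in> U" for n x
    using that by (intro exI[of _ "Suc n"]) (simp add: funpow_swap1)
  then show ?thesis
    by (auto simp: minus_invariant_def backward_saturation_def)
qed

text \<open>The orbit of the common point \<open>x\<close> visits \<open>U\<close> at time
  \<open>m\<close> and \<open>V\<close> at time \<open>n\<close>. The earlier visit flows into the
  later one in the remaining steps, and the order of \<open>m\<close> and \<open>n\<close> selects
  the disjunct.\<close>

lemma backward_saturations_meetD:
  assumes f: "continuous_map X X f"
    and x: "x \<in> backward_saturation X f U" "x \<in> backward_saturation X f V"
  shows "\<exists>n. (\<exists>x\<in>U. (f ^^ n) x \<in> V) \<or> (\<exists>y\<in>V. (f ^^ n) y \<in> U)"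
proof -
  obtain m n where mn: "(f ^^ m) x \<in> U" "(f ^^ n) x \<in> V"
    using x by (auto simp: backward_saturation_def)
  have split: "(f ^^ j) x = (f ^^ (j - i)) ((f ^^ i) x)" if "i \<le> j" for i j
    using that by (metis comp_apply funpow_add le_add_diff_inverse2)
  show ?thesis
    using mn split[of m n] split[of n m] by (metis nat_le_linear)
qed

lemma topologically_transitive_iff_minus_invariant:
  assumes f: "continuous_map X X f"
  shows "topologically_transitive X f \<longleftrightarrow>
           \<not> (\<exists>U V. opene X U \<and> minus_invariant X f U \<and>
                    opene X V \<and> minus_invariant X f V \<and> U \<inter> V = {})"
    (is "_ \<longleftrightarrow> \<not> ?D")
proof
  assume trans: "topologically_transitive X f"
  show "\<not> ?D"
  proof
    assume ?D
    then obtain U V where U: "opene X U" "minus_invariant X f U"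
      and V: "opene X V" "minus_invariant X f V" and disj: "U \<inter> V = {}" by blast
    have sub: "U \<subseteq> topspace X" "V \<subseteq> topspace X"
      using U V by (auto simp: minus_invariant_def)
    have "hitting_times X f U V \<noteq> {}"
      using trans U V by (auto simp: topologically_transitive_def)
    then obtain n where "(\<exists>x\<in>U. (f ^^ n) x \<in> V) \<or> (\<exists>y\<in>V. (f ^^ n) y \<in> U)"
      using hitting_times_nonempty_iff[OF sub] by blast
    \<comment> \<open>An orbit from \<open>U\<close> to \<open>V\<close> starts in \<open>V\<close>
      by -invariance of \<open>V\<close>, and one from \<open>V\<close> to \<open>U\<close> starts
      in \<open>U\<close> likewise; either way the starting point lies in both sets.\<close>
    then show False
      using minus_invariant_funpow[OF f U(2)] minus_invariant_funpow[OF f V(2)] sub disj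
      by blast
  qed
next
  assume D: "\<not> ?D"
  show "topologically_transitive X f"
    unfolding topologically_transitive_def
  proof (intro allI impI)
    fix U V assume UV: "opene X U \<and> opene X V"
    then have sub: "U \<subseteq> topspace X" "V \<subseteq> topspace X"
      by (auto simp: opene_def dest: openin_subset)
    \<comment> \<open>Otherwise the two saturations would be a disjoint pair of the excluded
      kind.\<close>
    have "backward_saturation X f U \<inter> backward_saturation X f V \<noteq> {}"
      using D UV opene_backward_saturation[OF f] minus_invariant_backward_saturation by blast
    then show "hitting_times X f U V \<noteq> {}"
      unfolding hitting_times_nonempty_iff[OF sub]
      using backward_saturations_meetD[OF f] by blast
  qed
qed

text \<open>This is contraposition. Continuity supplies that \<open>f\<close> preserves the carrier,
  so a value \<open>f x\<close> outside \<open>U\<close> does lie in the complement.\<close>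

lemma plus_invariant_complement_iff:
  assumes "continuous_map X X f" "U \<subseteq> topspace X"
  shows "plus_invariant X f (topspace X - U) \<longleftrightarrow> minus_invariant X f U"
  using assms by (auto simp: plus_invariant_def minus_invariant_def continuous_map_def)

text \<open>Under complementation nonempty becomes proper, and by De Morgan a disjoint pair becomes
  a cover.\<close>

lemma disjoint_minus_invariant_iff_plus_invariant_cover:
  assumes f: "continuous_map X X f"
  shows "(\<exists>U V. opene X U \<and> minus_invariant X f U \<and>
                opene X V \<and> minus_invariant X f V \<and> U \<inter> V = {}) \<longleftrightarrow>
         (\<exists>A B. closedin X A \<and> plus_invariant X f A \<and> A \<noteq> topspace X \<and>
                closedin X B \<and> plus_invariant X f B \<and> B \<noteq> topspace X \<and>
                A \<union> B = topspace X)"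
    (is "?L \<longleftrightarrow> ?R")
proof
  have *: "closedin X (topspace X - U) \<and> plus_invariant X f (topspace X - U) \<and>
           topspace X - U \<noteq> topspace X"
    if "opene X U" "minus_invariant X f U" for U
    using that plus_invariant_complement_iff[OF f, of U] openin_subset[of X U]
    by (auto simp: opene_def)
  assume ?L
  then obtain U V where UV: "opene X U" "minus_invariant X f U"
    "opene X V" "minus_invariant X f V" "U \<inter> V = {}" by blast
  then have "(topspace X - U) \<union> (topspace X - V) = topspace X" by blast
  then show ?R using *[OF UV(1,2)] *[OF UV(3,4)] by blast
next
  have *: "opene X (topspace X - A) \<and> minus_invariant X f (topspace X - A)"
    if "closedin X A" "plus_invariant X f A" "A \<noteq> topspace X" for A
    \<comment> \<open>The lemma is applied to the complement of \<open>A\<close>, whose own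
      complement is \<open>A\<close> again.\<close>
    using that plus_invariant_complement_iff[OF f, of "topspace X - A"] closedin_subset[of X A]
    by (auto simp: opene_def double_diff)
  assume ?R
  then obtain A B where AB: "closedin X A" "plus_invariant X f A" "A \<noteq> topspace X"
    "closedin X B" "plus_invariant X f B" "B \<noteq> topspace X" "A \<union> B = topspace X" by blast
  then have "(topspace X - A) \<inter> (topspace X - B) = {}" by blast
  then show ?L using *[OF AB(1-3)] *[OF AB(4-6)] by blast
qed

theorem proposition1p3:
  fixes X :: "'a topology" and f :: "'a \<Rightarrow> 'a"
  assumes "dynamical_system X f"
  shows "(topologically_transitive X f \<longleftrightarrow>
           \<not> (\<exists>U V. opene X U \<and> minus_invariant X f U \<and>
                    opene X V \<and> minus_invariant X f V \<and> U \<inter> V = {}))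
       \<and> (topologically_transitive X f \<longleftrightarrow>
           \<not> (\<exists>A B. closedin X A \<and> plus_invariant X f A \<and> A \<noteq> topspace X \<and>
                    closedin X B \<and> plus_invariant X f B \<and> B \<noteq> topspace X \<and>
                    A \<union> B = topspace X))"
proof -
  have f: "continuous_map X X f"
    using assms by (simp add: dynamical_system_def)
  show ?thesis
    using topologically_transitive_iff_minus_invariant[OF f]
      disjoint_minus_invariant_iff_plus_invariant_cover[OF f] by (simp only: simp_thms)
qed

end
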